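(* Let $d\ge1$ and let $M_d=M_d(\beta)$ be a positive semidefinite, recursively generated, recursively determinate real bivariate moment matrix. If $M_d$ admits positive semidefinite, recursively generated moment matrix extensions $M_{d+1},\ldots,M_{2d-1}$ (each extending the previous one), then $\beta$ has a representing measure.
   Context: $\mathcal P_k$ is the space of real polynomials in $x,y$ of total degree at most $k$; for $f\in\mathcal P_k$, $\hat f$ is its coefficient vector with respect to the monomials in degree-lexicographic order. For a real sequence $\beta=\{\beta_{ij}\}_{i,j\ge0,\,i+j\le 2k}$, the moment matrix $M_k=M_k(\beta)$ has rows and columns indexed by the monomials of degree at most $k$ (denoted $1,X,Y,\ldots,X^k,\ldots,Y^k$), and the entry in row $X^iY^j$, column $X^sY^t$ is $\beta_{i+s,j+t}$. For $f=\sum a_{ij}x^iy^j\in\mathcal P_k$, $f(X,Y):=\sum a_{ij}X^iY^j=M_k\hat f$. $M_k$ is recursively generated if $f,g,fg\in\mathcal P_k$ and $f(X,Y)=0$ imply $(fg)(X,Y)=0$. A moment matrix extension $M_{k+1}$ of $M_k$ is the moment matrix of a real sequence of degree $2k+2$ extending $\beta$. $M_d$ is recursively determinate if there are column relations $X^n=p(X,Y)$ with $1\le n\le d$, $p\in\mathcal P_{n-1}$, and $Y^m=q(X,Y)$ with $1\le m\le d$, $q\in\mathcal P_m$, $q$ having no $y^m$ term; or similar relations with the roles of $p$ and $q$ reversed (i.e., $Y^m=q(X,Y)$ with $q\in\mathcal P_{m-1}$, and $X^n=p(X,Y)$ with $p\in\mathcal P_n$, $p$ having no $x^n$ term). A representing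 measure for $\beta=\{\beta_{ij}\}_{i+j\le 2d}$ is a positive Borel measure $\mu$ on $\mathbb R^2$ with $\beta_{ij}=\int x^iy^j\,d\mu$ for all $i,j\ge0$, $i+j\le 2d$. *)

theory Defs
  imports
    "HOL-Analysis.Bochner_Integration"
    "HOL-Library.Poly_Mapping"
    "HOL-Library.Product_Plus"
    "Jordan_Normal_Form.Matrix"
begin

text \<open>
  Real bivariate polynomials are finitely supported maps from exponent pairs to coefficients:
  \<open>lookup f (i, j)\<close> is the coefficient of \<open>x^i y^j\<close>.  Exponent pairs add
  componentwise (\<open>Product_Plus\<close>), so multiplication of the type \<open>bipoly\<close> is
  polynomial multiplication.
\<close>

type_synonym bipoly = "(nat \<times> nat) \<Rightarrow>\<^sub>0 real"

definition polys_upto :: "nat \<Rightarrow> bipoly set" where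
  "polys_upto k = {f. \<forall>(i, j) \<in> Poly_Mapping.keys f. i + j \<le> k}"

abbreviation bmonom :: "nat \<Rightarrow> nat \<Rightarrow> bipoly" where
  "bmonom i j \<equiv> Poly_Mapping.single (i, j) 1"

text \<open>Exponents in degree-lexicographic order \<open>1, X, Y, X^2, XY, Y^2, \<dots>, X^k, \<dots>, Y^k\<close>.\<close>

definition monoms_upto :: "nat \<Rightarrow> (nat \<times> nat) list" where
  "monoms_upto k = concat (map (\<lambda>n. map (\<lambda>j. (n - j, j)) [0..<Suc n]) [0..<Suc k])"

definition coeff_vec :: "nat \<Rightarrow> bipoly \<Rightarrow> real Matrix.vec" where
  "coeff_vec k f = Matrix.vec (length (monoms_upto k))
     (\<lambda>r. Poly_Mapping.lookup f (monoms_upto k ! r))"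

text \<open>
  A sequence of degree \<open>2k\<close> is represented by a total function \<open>\<beta>\<close>; only the values
  \<open>\<beta> i j\<close> with \<open>i + j \<le> 2k\<close> matter in the notions below.
\<close>

definition moment_matrix :: "nat \<Rightarrow> (nat \<Rightarrow> nat \<Rightarrow> real) \<Rightarrow> real Matrix.mat" where
  "moment_matrix k \<beta> = Matrix.mat (length (monoms_upto k)) (length (monoms_upto k))
     (\<lambda>(r, c). case (monoms_upto k ! r, monoms_upto k ! c) of
        ((i, j), (s, t)) \<Rightarrow> \<beta> (i + s) (j + t))"

text \<open>The column-space element \<open>f(X,Y)\<close>, for \<open>f\<close> of degree at most \<open>k\<close>.\<close>

definition column_eval :: "nat \<Rightarrow> (nat \<Rightarrow> nat \<Rightarrow> real) \<Rightarrow> bipoly \<Rightarrow> real Matrix.vec" where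
  "column_eval k \<beta> f = moment_matrix k \<beta> *\<^sub>v coeff_vec k f"

definition positive_semidefinite :: "real Matrix.mat \<Rightarrow> bool" where
  "positive_semidefinite A \<longleftrightarrow>
     A \<in> carrier_mat (dim_row A) (dim_row A) \<and> transpose_mat A = A \<and>
     (\<forall>v \<in> carrier_vec (dim_row A). scalar_prod v (A *\<^sub>v v) \<ge> 0)"

definition recursively_generated :: "nat \<Rightarrow> (nat \<Rightarrow> nat \<Rightarrow> real) \<Rightarrow> bool" where
  "recursively_generated k \<beta> \<longleftrightarrow>
     (\<forall>f g. f \<in> polys_upto k \<and> g \<in> polys_upto k \<and> f * g \<in> polys_upto k \<and>
        column_eval k \<beta> f = 0\<^sub>v (length (monoms_upto k)) \<longrightarrow>
        column_eval k \<beta> (f * g) = 0\<^sub>v (length (monoms_upto k)))"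

definition recursively_determinate :: "nat \<Rightarrow> (nat \<Rightarrow> nat \<Rightarrow> real) \<Rightarrow> bool" where
  "recursively_determinate d \<beta> \<longleftrightarrow>
     (\<exists>n m p q. 1 \<le> n \<and> n \<le> d \<and> 1 \<le> m \<and> m \<le> d \<and>
        column_eval d \<beta> (bmonom n 0) = column_eval d \<beta> p \<and>
        column_eval d \<beta> (bmonom 0 m) = column_eval d \<beta> q \<and>
        (p \<in> polys_upto (n - 1) \<and> q \<in> polys_upto m \<and> Poly_Mapping.lookup q (0, m) = 0 \<or>
         q \<in> polys_upto (m - 1) \<and> p \<in> polys_upto n \<and> Poly_Mapping.lookup p (n, 0) = 0))"

definition extends_moments ::
    "nat \<Rightarrow> (nat \<Rightarrow> nat \<Rightarrow> real) \<Rightarrow> (nat \<Rightarrow> nat \<Rightarrow> real) \<Rightarrow> bool" where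
  "extends_moments k \<beta> \<beta>' \<longleftrightarrow> (\<forall>i j. i + j \<le> 2 * k \<longrightarrow> \<beta>' i j = \<beta> i j)"

definition representing_measure ::
    "nat \<Rightarrow> (nat \<Rightarrow> nat \<Rightarrow> real) \<Rightarrow> (real \<times> real) measure \<Rightarrow> bool" where
  "representing_measure d \<beta> \<mu> \<longleftrightarrow> sets \<mu> = sets borel \<and>
     (\<forall>i j. i + j \<le> 2 * d \<longrightarrow> has_bochner_integral \<mu> (\<lambda>(x, y). x ^ i * y ^ j) (\<beta> i j))"

end

theory Submission
  imports Defs "HOL-Computational_Algebra.Fundamental_Theorem_Algebra"
begin

text \<open>
  Let \<open>K = 2 d - 1\<close>, and let \<open>g\<^sub>1, g\<^sub>2\<close> be the two relations, with leading monomials \<open>x^n\<close> and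
  \<open>y^m\<close> in a suitable degree-compatible order.  Positivity and recursive generation of \<open>M_K\<close> make
  the Riesz functional of \<open>M_K\<close> vanish on all multiples of \<open>g\<^sub>1\<close> and \<open>g\<^sub>2\<close> of degree at most \<open>2 K\<close>.
  As \<open>n + m - 2 \<le> K\<close>, every monomial of degree greater than \<open>K\<close> is divisible by \<open>x^n\<close> or \<open>y^m\<close>, so
  the relations serve as recurrences that extend the moments to all degrees; as the leading
  monomials are coprime, no inconsistency arises (Buchberger's first criterion) and the extended
  functional \<open>L\<close> vanishes on the ideal \<open>(g\<^sub>1, g\<^sub>2)\<close>.  Modulo this ideal every polynomial has
  degree at most \<open>K\<close>, so \<open>L\<close> is nonnegative on squares and its null ideal
  \<open>I = {f. L (f h) = 0 for all h}\<close> has finite codimension.  Hence \<open>I\<close> contains nonzero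
  polynomials \<open>a(x)\<close> and \<open>b(y)\<close>; since \<open>I\<close> is a real ideal, they may be taken to be products of
  distinct real linear factors.  The corresponding eigen-idempotents modulo \<open>I\<close> exhibit \<open>L\<close> as a
  nonnegative combination of point evaluations.
\<close>

section \<open>Positive functionals with univariate polynomials in the null ideal\<close>

abbreviation cst :: "real \<Rightarrow> bipoly" where
  "cst c \<equiv> Poly_Mapping.single 0 c"

lemma cst_mult: "cst (a * b) = cst a * cst b"
  by (simp add: mult_single)

text \<open>The substituted \<open>z\<close> is arbitrary, so that the same lemmas later serve both
  coordinates, with \<open>z\<close> equal to x or to y.\<close>

definition upoly_eval :: "bipoly \<Rightarrow> real poly \<Rightarrow> bipoly" where
  "upoly_eval z a = poly (map_poly cst a) z"

lemma upoly_eval_0 [simp]: "upoly_eval z 0 = 0"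
  by (simp add: upoly_eval_def)

lemma upoly_eval_pCons: "upoly_eval z (pCons c a) = cst c + z * upoly_eval z a"
  by (simp add: upoly_eval_def map_poly_pCons)

lemma upoly_eval_add: "upoly_eval z (a + b) = upoly_eval z a + upoly_eval z b"
  by (induction a b rule: poly_induct2) (simp_all add: upoly_eval_pCons single_add algebra_simps)

lemma upoly_eval_smult: "upoly_eval z (smult c a) = cst c * upoly_eval z a"
  by (induction a) (simp_all add: upoly_eval_pCons cst_mult algebra_simps)

lemma upoly_eval_mult: "upoly_eval z (a * b) = upoly_eval z a * upoly_eval z b"
  by (induction a)
    (simp_all add: upoly_eval_pCons upoly_eval_add upoly_eval_smult algebra_simps)

lemma upoly_eval_sum: "upoly_eval z (sum f A) = (\<Sum>i\<in>A. upoly_eval z (f i))"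
  by (induction A rule: infinite_finite_induct) (simp_all add: upoly_eval_add)

lemma upoly_eval_monom: "upoly_eval z (Polynomial.monom c n) = cst c * z ^ n"
  by (induction n) (simp_all add: monom_0 monom_Suc upoly_eval_pCons algebra_simps)

text \<open>A complex root \<open>w\<close> exists by the fundamental theorem of algebra. A real
  root splits off a linear factor, and a non-real one the quadratic with roots \<open>w\<close> and
  its conjugate, written as a square plus a positive constant because that is the form in which
  positivity is used.\<close>

lemma real_poly_factor:
  fixes a :: "real poly"
  assumes "degree a > 0"
  obtains u b where "a = [:- u, 1:] * b"
  | u v b where "v \<noteq> 0" "a = ([:- u, 1:] * [:- u, 1:] + [:v * v:]) * b"
proof -
  let ?R = "map_poly complex_of_real"
  have ev: "poly (?R (p + q)) w = poly (?R p) w + poly (?R q) w" for p q :: "real poly" and w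
    by (induction p q rule: poly_induct2) (simp_all add: map_poly_pCons algebra_simps)
  have evs: "poly (?R (smult c p)) w = of_real c * poly (?R p) w" for c p w
    by (induction p) (simp_all add: map_poly_pCons algebra_simps)
  have evm: "poly (?R (p * q)) w = poly (?R p) w * poly (?R q) w" for p q :: "real poly" and w
    by (induction p) (simp_all add: map_poly_pCons ev evs algebra_simps)
  have evr: "poly (?R p) (of_real t) = of_real (poly p t)" for p t
    by (induction p) (simp_all add: map_poly_pCons)
  have "degree (?R a) = degree a"
    by (simp add: degree_map_poly)
  then have "\<not> constant (poly (?R a))"
    using assms by (simp add: constant_degree)
  then obtain w where w: "poly (?R a) w = 0"
    using fundamental_theorem_of_algebra by blast
  show ?thesis
  proof (cases "Im w = 0")
    case True
    then have "w = of_real (Re w)"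
      by (simp add: complex_eq_iff)
    then have "poly a (Re w) = 0"
      using w evr by (metis of_real_eq_0_iff)
    then show ?thesis
      using that(1) poly_eq_0_iff_dvd by (metis dvdE)
  next
    case False
    let ?q = "[:- Re w, 1:] * [:- Re w, 1:] + [:Im w * Im w:]"
    have q: "degree ?q = 2" and "?q \<noteq> 0"
      by simp_all
    have qw: "poly (?R ?q) w = 0"
      by (simp add: map_poly_pCons complex_eq_iff algebra_simps)
    define r where "r = a mod ?q"
    have a: "a = ?q * (a div ?q) + r"
      unfolding r_def by (rule mult_div_mod_eq[symmetric])
    then have "poly (?R r) w = 0"
      using w qw by (metis ev evm add_0 mult_zero_left)
    moreover have "degree r < 2"
      using degree_mod_less'[of ?q a] q \<open>?q \<noteq> 0\<close> unfolding r_def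
      by (metis degree_0 zero_less_numeral)
    then obtain r0 r1 where "r = [:r0, r1:]"
      by (metis One_nat_def degree_eq_zeroE degree_pCons_eq_if less_2_cases pCons_0_0 pCons_cases Suc_inject
          nat.distinct(1))
    \<comment> \<open>From r0 + r1 w = 0 with w not real, the imaginary part gives r1 = 0 and then
      r0 = 0.\<close>
    ultimately have "r = 0"
      using False by (auto simp: map_poly_pCons complex_eq_iff)
    with a False show ?thesis
      using that(2)[of "Im w" "Re w" "a div ?q"] by simp
  qed
qed

section \<open>Linear functionals and their null ideals\<close>

lemma quadratic_nonneg_cross_zero:
  fixes a b :: real
  assumes "\<And>t. 0 \<le> a + 2 * t * b"
  shows "b = 0"
proof (rule ccontr)
  assume "b \<noteq> 0"
  \<comment> \<open>At the chosen \<open>t\<close> the affine function takes the value -1.\<close>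
  then show False
    using assms[of "- (a + 1) / (2 * b)"] by (simp add: field_simps)
qed

text \<open>Positivity is kept out, so that the null ideal is available for the extended moment
  functional before that functional is known to be positive.\<close>

locale bipoly_functional =
  fixes L :: "bipoly \<Rightarrow> real"
  assumes L_add: "L (f + g) = L f + L g"
    and L_cst: "L (cst c * f) = c * L f"
begin

lemma L_0 [simp]: "L 0 = 0"
  using L_cst[of 0 0] by simp

lemma L_minus: "L (- f) = - L f"
  using L_add[of f "- f"] by simp

lemma L_diff: "L (f - g) = L f - L g"
  using L_add[of f "- g"] by (simp add: L_minus)

lemma L_sum: "L (sum f A) = (\<Sum>i\<in>A. L (f i))"
  by (induction A rule: infinite_finite_induct) (simp_all add: L_add)

text \<open>This is the radical of the bilinear form sending (f, g) to L (f g). It is an ideal on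
  which \<open>L\<close> vanishes, so \<open>L\<close> can be computed modulo it.\<close>

definition null :: "bipoly set" where
  "null = {f. \<forall>h. L (f * h) = 0}"

lemma nullD: "f \<in> null \<Longrightarrow> L f = 0"
  by (metis (mono_tags) mem_Collect_eq mult.right_neutral null_def)

lemma null_0 [simp]: "0 \<in> null"
  by (simp add: null_def)

lemma null_add: "f \<in> null \<Longrightarrow> g \<in> null \<Longrightarrow> f + g \<in> null"
  by (simp add: null_def distrib_right L_add)

lemma null_mult: "f \<in> null \<Longrightarrow> h * f \<in> null"
  by (simp add: null_def) (metis mult.assoc mult.commute)

lemma null_diff: "f \<in> null \<Longrightarrow> g \<in> null \<Longrightarrow> f - g \<in> null"
  by (simp add: null_def left_diff_distrib L_diff)

lemma null_sum: "(\<And>i. i \<in> A \<Longrightarrow> f i \<in> null) \<Longrightarrow> sum f A \<in> null"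
  by (induction A rule: infinite_finite_induct) (auto intro: null_add)

text \<open>Degenerate case of the Cauchy-Schwarz inequality. Positivity is assumed only along the
  line h + t f, so the lemma also applies to truncated functionals, which are positive only up to
  some degree.\<close>

lemma cross_zero_if_square_zero:
  assumes "\<And>t. 0 \<le> L ((h + cst t * f) * (h + cst t * f))" "L (f * f) = 0"
  shows "L (f * h) = 0"
proof (rule quadratic_nonneg_cross_zero)
  fix t
  have "(h + cst t * f) * (h + cst t * f) =
      h * h + cst (2 * t) * (f * h) + cst (t * t) * (f * f)"
    unfolding cst_mult by (simp add: algebra_simps)
  then show "0 \<le> L (h * h) + 2 * t * L (f * h)"
    using assms(1)[of t] assms(2) by (simp add: L_add L_cst)
qed

end

locale psd_functional = bipoly_functional +
  assumes L_square: "0 \<le> L (f * f)"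
begin

lemma null_if_square: "L (f * f) = 0 \<Longrightarrow> f \<in> null"
  unfolding null_def using cross_zero_if_square_zero L_square by blast

text \<open>This and the next lemma are the two facets of the null ideal being real that are needed.
  Multiplying the hypothesis by \<open>f\<close> makes \<open>L\<close> vanish on a square, here (g
  f)^2, and on the sum (g f)^2 + v^2 f^2 in the next lemma, where both summands contribute
  nonnegatively.\<close>

lemma null_if_square_mult:
  assumes "g * g * f \<in> null"
  shows "g * f \<in> null"
proof (rule null_if_square)
  have "f * (g * g * f) \<in> null"
    by (rule null_mult[OF assms])
  then show "L (g * f * (g * f)) = 0"
    by (auto dest: nullD simp: mult_ac)
qed

lemma null_if_sum_squares:
  assumes "(g * g + cst (v * v)) * f \<in> null" "v \<noteq> 0"
  shows "f \<in> null"
proof (rule null_if_square)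
  have "L (f * ((g * g + cst (v * v)) * f)) = 0"
    using assms by (blast intro: nullD null_mult)
  moreover have "f * ((g * g + cst (v * v)) * f) = g * f * (g * f) + cst (v * v) * (f * f)"
    by (simp add: algebra_simps)
  ultimately have "L (g * f * (g * f)) + v * v * L (f * f) = 0"
    by (simp add: L_add L_cst)
  then have "v * v * L (f * f) = 0"
    using L_square[of "g * f"] L_square[of f]
    by (smt (verit) mult_nonneg_nonneg zero_le_square)
  then show "L (f * f) = 0"
    using assms(2) by simp
qed

text \<open>The factors of \<open>a\<close> are stripped one at a time, by induction on the degree.
  Linear factors are collected in \<open>S\<close>, and quadratic factors without real roots are
  cancelled because the null ideal is real. Starting from empty \<open>S\<close>, this leaves a
  product of distinct real linear factors.\<close>

lemma null_product_of_real_roots: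
  assumes "a \<noteq> 0" "finite S" "upoly_eval z a * (\<Prod>s\<in>S. z - cst s) \<in> null"
  shows "\<exists>S'. finite S' \<and> (\<Prod>s\<in>S'. z - cst s) \<in> null"
  using assms
proof (induction "degree a" arbitrary: a S rule: less_induct)
  case less
  show ?case
  proof (cases "degree a = 0")
    case True
    then obtain c where c: "a = [:c:]"
      by (meson degree_eq_zeroE)
    with less.prems have "c \<noteq> 0" and *: "cst c * (\<Prod>s\<in>S. z - cst s) \<in> null"
      by (simp_all add: upoly_eval_pCons)
    have "cst (1 / c) * cst c = 1"
      using \<open>c \<noteq> 0\<close> by (simp add: mult_single)
    then have "(\<Prod>s\<in>S. z - cst s) \<in> null"
      using null_mult[OF *, of "cst (1 / c)"] by (simp add: mult.assoc[symmetric])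
    then show ?thesis
      using less.prems by blast
  next
    case False
    then have "degree a > 0"
      by simp
    then show ?thesis
    proof (cases rule: real_poly_factor)
      case (1 u b)
      have "b \<noteq> 0"
        using 1 less.prems(1) by auto
      then have "degree a = 1 + degree b"
        unfolding 1 by (subst degree_mult_eq) simp_all
      with \<open>b \<noteq> 0\<close> have b: "b \<noteq> 0" "degree b < degree a"
        by simp_all
      have null: "(z - cst u) * upoly_eval z b * (\<Prod>s\<in>S. z - cst s) \<in> null"
        using less.prems(3) unfolding 1 upoly_eval_mult
        by (simp add: upoly_eval_pCons single_uminus)
      have "upoly_eval z b * (\<Prod>s\<in>insert u S. z - cst s) \<in> null"
      \<comment> \<open>A root already in \<open>S\<close> makes the factor occur twice;
        \<open>null_if_square_mult\<close> reduces the square to a single factor.\<close>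
      proof (cases "u \<in> S")
        case True
        let ?f = "upoly_eval z b * (\<Prod>s\<in>S - {u}. z - cst s)"
        have "(z - cst u) * (z - cst u) * ?f \<in> null"
          using null True prod.remove[OF less.prems(2) True, of "\<lambda>s. z - cst s"]
          by (simp add: mult_ac)
        then have "(z - cst u) * ?f \<in> null"
          by (rule null_if_square_mult)
        then show ?thesis
          using True prod.remove[OF less.prems(2) True, of "\<lambda>s. z - cst s"]
          by (simp add: mult_ac insert_absorb)
      next
        case False
        then show ?thesis
          using null less.prems(2) by (simp add: mult_ac)
      qed
      then show ?thesis
        using less.hyps[OF b(2) b(1), of "insert u S"] less.prems(2) by blast
    next
      case (2 u v b)
      let ?q = "[:- u, 1:] * [:- u, 1:] + [:v * v:]"
      have "degree ?q = 2" "?q \<noteq> 0"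
        by simp_all
      have "b \<noteq> 0"
        using 2(2) less.prems(1) by auto
      have "degree (?q * b) = degree ?q + degree b"
        by (rule degree_mult_eq[OF \<open>?q \<noteq> 0\<close> \<open>b \<noteq> 0\<close>])
      then have "degree a = 2 + degree b"
        by (simp only: 2(2) \<open>degree ?q = 2\<close>)
      with \<open>b \<noteq> 0\<close> have b: "b \<noteq> 0" "degree b < degree a"
        by simp_all
      have "upoly_eval z ?q = (z - cst u) * (z - cst u) + cst (v * v)"
        unfolding upoly_eval_add upoly_eval_mult by (simp add: upoly_eval_pCons single_uminus)
      then have "((z - cst u) * (z - cst u) + cst (v * v)) *
          (upoly_eval z b * (\<Prod>s\<in>S. z - cst s)) \<in> null"
        using less.prems(3) unfolding 2(2) upoly_eval_mult by (simp add: mult.assoc)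
      then have "upoly_eval z b * (\<Prod>s\<in>S. z - cst s) \<in> null"
        using null_if_sum_squares 2(1) by blast
      then show ?thesis
        using less.hyps[OF b(2) b(1)] less.prems(2) by blast
    qed
  qed
qed

text \<open>Modulo the null ideal, \<open>h\<close> is killed by a product of distinct linear
  factors in \<open>z\<close>, hence is a sum of eigenvectors of multiplication by \<open>z\<close>.
  The induction decomposes (z - u) h over \<open>S\<close> and then inverts z - u on each
  eigenvector.\<close>

lemma null_eigen_decomposition:
  assumes "finite S" "h * (\<Prod>s\<in>S. z - cst s) \<in> null"
  shows "\<exists>e. (\<forall>s\<in>S. (z - cst s) * e s \<in> null) \<and> h - sum e S \<in> null"
  using assms
proof (induction S arbitrary: h rule: finite_induct)
  case empty
  then show ?case
    by simp
next
  case (insert u S)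
  have "(z - cst u) * h * (\<Prod>s\<in>S. z - cst s) \<in> null"
    using insert by (simp add: mult_ac)
  with insert.IH obtain e where e: "\<And>s. s \<in> S \<Longrightarrow> (z - cst s) * e s \<in> null"
      and h: "(z - cst u) * h - sum e S \<in> null"
    by blast
  \<comment> \<open>On \<open>e s\<close> the factor z - u acts as the nonzero scalar s - u, so
    \<open>e' s\<close> is a preimage of \<open>e s\<close> under z - u. The remainder
    \<open>k\<close> is then annihilated by z - u and is the eigenvector for
    \<open>u\<close>.\<close>
  define e' where "e' s = cst (1 / (s - u)) * e s" for s
  define k where "k = h - sum e' S"
  have e'1: "(z - cst s) * e' s \<in> null" if "s \<in> S" for s
    using null_mult[OF e[OF that], of "cst (1 / (s - u))"] by (simp add: e'_def mult_ac)
  have e'2: "(z - cst u) * e' s - e s \<in> null" if "s \<in> S" for s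
  proof -
    have "s - u \<noteq> 0"
      using that insert.hyps by auto
    then have "cst (1 / (s - u)) * (cst s - cst u) = 1"
      by (simp add: mult_single flip: single_diff)
    then have "(z - cst u) * e' s - e s =
        (z - cst u) * e' s - cst (1 / (s - u)) * (cst s - cst u) * e s"
      by simp
    also have "\<dots> = (z - cst s) * e' s"
      by (simp add: e'_def algebra_simps)
    finally show ?thesis
      using e'1[OF that] by simp
  qed
  have "(z - cst u) * k = ((z - cst u) * h - sum e S) - (\<Sum>s\<in>S. (z - cst u) * e' s - e s)"
    by (simp add: k_def right_diff_distrib sum_distrib_left sum_subtractf)
  then have k: "(z - cst u) * k \<in> null"
    using null_diff[OF h null_sum[of S, OF e'2]] by simp
  have "(\<Sum>s\<in>S. (e'(u := k)) s) = sum e' S"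
    using insert.hyps by (intro sum.cong) auto
  then have "h - (\<Sum>s\<in>insert u S. (e'(u := k)) s) \<in> null"
    using insert.hyps by (simp add: k_def)
  moreover have "\<forall>s\<in>insert u S. (z - cst s) * (e'(u := k)) s \<in> null"
    using k e'1 insert.hyps by auto
  ultimately show ?case
    by blast
qed

text \<open>Decompose 1 into eigenvectors. Those with different eigenvalues have product zero, since
  (t - s) e_s e_t is a combination of the two eigenvector relations; multiplying 1 = sum of all e_t
  by e_s then gives e_s = e_s^2 modulo the null ideal.\<close>

lemma null_orthogonal_idempotents:
  assumes "finite S" "(\<Prod>s\<in>S. z - cst s) \<in> null"
  obtains e where "\<And>s. s \<in> S \<Longrightarrow> (z - cst s) * e s \<in> null" "1 - sum e S \<in> null"
    "\<And>s. s \<in> S \<Longrightarrow> e s - e s * e s \<in> null"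
proof -
  obtain e where e: "\<And>s. s \<in> S \<Longrightarrow> (z - cst s) * e s \<in> null" and 1: "1 - sum e S \<in> null"
    using null_eigen_decomposition[of S 1 z] assms by auto
  have orth: "e s * e t \<in> null" if "s \<in> S" "t \<in> S" "s \<noteq> t" for s t
  proof -
    have "e t * ((z - cst s) * e s) - e s * ((z - cst t) * e t) \<in> null"
      using that by (intro null_diff null_mult e)
    then have "cst (1 / (t - s)) * (e t * ((z - cst s) * e s) - e s * ((z - cst t) * e t)) \<in> null"
      by (rule null_mult)
    moreover have "cst (1 / (t - s)) * (e t * ((z - cst s) * e s) - e s * ((z - cst t) * e t)) =
        (cst (1 / (t - s)) * (cst t - cst s)) * (e s * e t)"
      by (simp add: algebra_simps)
    moreover have "cst (1 / (t - s)) * (cst t - cst s) = 1"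
      using that by (simp add: mult_single flip: single_diff)
    ultimately show ?thesis
      by simp
  qed
  have "e s - e s * e s \<in> null" if s: "s \<in> S" for s
  proof -
    have "(\<Sum>t\<in>S - {s}. e s * e t) \<in> null"
      using orth s by (intro null_sum) auto
    then have "e s * (1 - sum e S) + (\<Sum>t\<in>S - {s}. e s * e t) \<in> null"
      using 1 by (intro null_add null_mult)
    moreover have "e s * (1 - sum e S) + (\<Sum>t\<in>S - {s}. e s * e t) = e s - e s * e s"
      using sum.remove[OF assms(1) s, of e]
      by (simp add: algebra_simps sum_distrib_left)
    ultimately show ?thesis
      by simp
  qed
  with e 1 that show ?thesis
    by blast
qed

lemma null_power:
  assumes "(z - cst s) * e \<in> null"
  shows "z ^ n * e - cst (s ^ n) * e \<in> null"
proof (induction n)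
  case (Suc n)
  have "z ^ Suc n * e - cst (s ^ Suc n) * e =
      z * (z ^ n * e - cst (s ^ n) * e) + cst (s ^ n) * ((z - cst s) * e)"
    using cst_mult[of s "s ^ n"] by (simp add: algebra_simps)
  then show ?case
    using null_add[OF null_mult[OF Suc] null_mult[OF assms]] by simp
qed simp

text \<open>The atoms form the grid \<open>S \<times> T\<close> of roots, with weights L (e_s f_t).
  A weight is nonnegative because e_s f_t is congruent to its own square; multiplication by e_s f_t
  evaluates a monomial at (s, t), and the products e_s f_t sum to 1 modulo the null ideal.\<close>

lemma finite_atomic_representation:
  assumes "a \<noteq> 0" "upoly_eval x a \<in> null" "b \<noteq> 0" "upoly_eval y b \<in> null"
  shows "\<exists>W w. finite W \<and> (\<forall>p\<in>W. 0 \<le> w p) \<and>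
    (\<forall>i j. L (x ^ i * y ^ j) = (\<Sum>p\<in>W. w p * (fst p ^ i * snd p ^ j)))"
proof -
  obtain S where S: "finite S" "(\<Prod>s\<in>S. x - cst s) \<in> null"
    using null_product_of_real_roots[of a "{}" x] assms by auto
  obtain T where T: "finite T" "(\<Prod>t\<in>T. y - cst t) \<in> null"
    using null_product_of_real_roots[of b "{}" y] assms by auto
  obtain e where e: "\<And>s. s \<in> S \<Longrightarrow> (x - cst s) * e s \<in> null" "1 - sum e S \<in> null"
      "\<And>s. s \<in> S \<Longrightarrow> e s - e s * e s \<in> null"
    using null_orthogonal_idempotents[OF S] by blast
  obtain f where f: "\<And>t. t \<in> T \<Longrightarrow> (y - cst t) * f t \<in> null" "1 - sum f T \<in> null"
      "\<And>t. t \<in> T \<Longrightarrow> f t - f t * f t \<in> null"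
    using null_orthogonal_idempotents[OF T] by blast
  have nonneg: "0 \<le> L (e s * f t)" if "s \<in> S" "t \<in> T" for s t
  proof -
    have "f t * (e s - e s * e s) + (e s * e s) * (f t - f t * f t) \<in> null"
      using that by (intro null_add null_mult e f)
    moreover have "f t * (e s - e s * e s) + (e s * e s) * (f t - f t * f t) =
        e s * f t - (e s * f t) * (e s * f t)"
      by (simp add: algebra_simps)
    ultimately have "L (e s * f t) = L ((e s * f t) * (e s * f t))"
      using nullD by (fastforce simp: L_diff)
    then show ?thesis
      using L_square by simp
  qed
  have atom: "L (x ^ i * y ^ j * (e s * f t)) = L (e s * f t) * (s ^ i * t ^ j)"
    if "s \<in> S" "t \<in> T" for i j s t
  proof -
    have "(y ^ j * f t) * (x ^ i * e s - cst (s ^ i) * e s) +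
        (cst (s ^ i) * e s) * (y ^ j * f t - cst (t ^ j) * f t) \<in> null"
      using that by (intro null_add null_mult null_power e f)
    moreover have "(y ^ j * f t) * (x ^ i * e s - cst (s ^ i) * e s) +
        (cst (s ^ i) * e s) * (y ^ j * f t - cst (t ^ j) * f t) =
        x ^ i * y ^ j * (e s * f t) - cst (s ^ i * t ^ j) * (e s * f t)"
      unfolding cst_mult by (simp add: algebra_simps)
    ultimately show ?thesis
      using nullD by (fastforce simp: L_diff L_cst)
  qed
  have prod_sum: "sum e S * sum f T = (\<Sum>p\<in>S \<times> T. e (fst p) * f (snd p))"
    by (simp add: sum_product sum.cartesian_product case_prod_unfold)
  have "L (x ^ i * y ^ j) =
      (\<Sum>p\<in>S \<times> T. L (e (fst p) * f (snd p)) * (fst p ^ i * snd p ^ j))" for i j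
  proof -
    have "(x ^ i * y ^ j) * (1 - sum e S) + (x ^ i * y ^ j * sum e S) * (1 - sum f T) \<in> null"
      by (intro null_add null_mult e f)
    moreover have "(x ^ i * y ^ j) * (1 - sum e S) + (x ^ i * y ^ j * sum e S) * (1 - sum f T) =
        x ^ i * y ^ j - x ^ i * y ^ j * (sum e S * sum f T)"
      by (simp add: algebra_simps)
    moreover have "\<dots> = x ^ i * y ^ j - (\<Sum>p\<in>S \<times> T. x ^ i * y ^ j * (e (fst p) * f (snd p)))"
      by (simp only: prod_sum sum_distrib_left[where A = "S \<times> T"])
    ultimately have "L (x ^ i * y ^ j) =
        (\<Sum>p\<in>S \<times> T. L (x ^ i * y ^ j * (e (fst p) * f (snd p))))"
      using nullD by (fastforce simp: L_diff L_sum)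
    also have "\<dots> = (\<Sum>p\<in>S \<times> T. L (e (fst p) * f (snd p)) * (fst p ^ i * snd p ^ j))"
      by (intro sum.cong refl) (auto intro!: atom)
    finally show ?thesis .
  qed
  then show ?thesis
    using S T nonneg
    by (intro exI[of _ "S \<times> T"] exI[of _ "\<lambda>p. L (e (fst p) * f (snd p))"]) auto
qed

end

section \<open>Riesz functionals\<close>

text \<open>A homogeneous system with more unknowns than equations, solved by Gaussian elimination:
  each induction step uses equation \<open>b\<close> to eliminate one pivot unknown
  \<open>k\<close>.\<close>

lemma nontrivial_linear_relation:
  fixes v :: "'i \<Rightarrow> 'b \<Rightarrow> real"
  assumes "finite B" "finite I" "card B < card I"
  shows "\<exists>c. (\<exists>i\<in>I. c i \<noteq> 0) \<and> (\<forall>b\<in>B. (\<Sum>i\<in>I. c i * v i b) = 0)"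
  using assms
proof (induction B arbitrary: I v rule: finite_induct)
  case empty
  then obtain i where "i \<in> I"
    by fastforce
  then show ?case
    by (intro exI[of _ "\<lambda>_. 1"]) auto
next
  case (insert b B)
  show ?case
  proof (cases "\<forall>i\<in>I. v i b = 0")
    case True
    then show ?thesis
      using insert.IH[of I v] insert.prems insert.hyps by simp
  next
    case False
    then obtain k where k: "k \<in> I" "v k b \<noteq> 0"
      by blast
    define t where "t i = v i b / v k b" for i
    have "card B < card (I - {k})"
      using insert k by simp
    then obtain c where c: "\<exists>i\<in>I - {k}. c i \<noteq> 0"
        "\<And>x. x \<in> B \<Longrightarrow> (\<Sum>i\<in>I - {k}. c i * (v i x - t i * v k x)) = 0"
      using insert.IH[of "I - {k}" "\<lambda>i x. v i x - t i * v k x"] insert.prems by auto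
    \<comment> \<open>The coefficient at the pivot is chosen so that the full sum equals the
      eliminated sum; at \<open>b\<close> each of its terms vanishes, as t_i is the ratio of the
      entries there.\<close>
    define c' where "c' = c(k := - (\<Sum>i\<in>I - {k}. c i * t i))"
    have sum: "(\<Sum>i\<in>I. c' i * v i x) = (\<Sum>i\<in>I - {k}. c i * (v i x - t i * v k x))" for x
    proof -
      have "(\<Sum>i\<in>I. c' i * v i x) = c' k * v k x + (\<Sum>i\<in>I - {k}. c' i * v i x)"
        using insert.prems k by (simp add: sum.remove)
      also have "(\<Sum>i\<in>I - {k}. c' i * v i x) = (\<Sum>i\<in>I - {k}. c i * v i x)"
        by (intro sum.cong) (auto simp: c'_def)
      finally show ?thesis
        by (simp add: c'_def algebra_simps sum_subtractf sum_distrib_left)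
    qed
    have "(\<Sum>i\<in>I. c' i * v i x) = 0" if "x \<in> insert b B" for x
    proof (cases "x = b")
      case True
      then show ?thesis
        using k by (simp add: sum t_def)
    next
      case False
      then show ?thesis
        using that by (simp add: sum c)
    qed
    moreover have "\<exists>i\<in>I. c' i \<noteq> 0"
      using c(1) by (auto simp: c'_def)
    ultimately show ?thesis
      by blast
  qed
qed

section \<open>Supports, expansions and total degrees\<close>

abbreviation keys :: "bipoly \<Rightarrow> (nat \<times> nat) set" where
  "keys \<equiv> Poly_Mapping.keys"

abbreviation lookup :: "bipoly \<Rightarrow> nat \<times> nat \<Rightarrow> real" where
  "lookup \<equiv> Poly_Mapping.lookup"

abbreviation pmon :: "nat \<times> nat \<Rightarrow> bipoly" where
  "pmon \<mu> \<equiv> Poly_Mapping.single \<mu> 1"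

lemma mon_add: "pmon (\<mu> + \<nu>) = pmon \<mu> * pmon \<nu>"
  by (simp add: mult_single)

lemma bipoly_expansion:
  assumes "finite A" "keys f \<subseteq> A"
  shows "f = (\<Sum>\<kappa>\<in>A. cst (lookup f \<kappa>) * pmon \<kappa>)"
proof (rule poly_mapping_eqI)
  fix k
  have "lookup (\<Sum>\<kappa>\<in>A. cst (lookup f \<kappa>) * pmon \<kappa>) k =
      (\<Sum>\<kappa>\<in>A. if \<kappa> = k then lookup f \<kappa> else 0)"
    unfolding lookup_sum by (intro sum.cong) (simp_all add: mult_single lookup_single when_def)
  also have "\<dots> = (if k \<in> A then lookup f k else 0)"
    using assms(1) by (rule sum.delta)
  also have "\<dots> = lookup f k"
    using assms(2) by (auto simp: in_keys_iff)
  finally show "lookup f k = lookup (\<Sum>\<kappa>\<in>A. cst (lookup f \<kappa>) * pmon \<kappa>) k" ..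
qed

lemma lookup_cst_mult: "lookup (cst c * f) \<kappa> = c * lookup f \<kappa>"
proof -
  have "cst c * f = cst c * (\<Sum>k\<in>keys f. cst (lookup f k) * pmon k)"
    by (subst (1) bipoly_expansion[of "keys f" f]) simp_all
  also have "\<dots> = (\<Sum>k\<in>keys f. Poly_Mapping.single k (c * lookup f k))"
    by (simp add: sum_distrib_left mult_single)
  finally have "lookup (cst c * f) \<kappa> = (\<Sum>k\<in>keys f. lookup (Poly_Mapping.single k (c * lookup f k)) \<kappa>)"
    by (simp only: lookup_sum)
  also have "\<dots> = (\<Sum>k\<in>keys f. if k = \<kappa> then c * lookup f k else 0)"
    by (intro sum.cong) (simp_all add: lookup_single when_def)
  also have "\<dots> = (if \<kappa> \<in> keys f then c * lookup f \<kappa> else 0)"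
    by (rule sum.delta) simp
  also have "\<dots> = c * lookup f \<kappa>"
    by (auto simp: in_keys_iff)
  finally show ?thesis .
qed

definition mdeg :: "nat \<times> nat \<Rightarrow> nat" where
  "mdeg \<mu> = fst \<mu> + snd \<mu>"

lemma mdeg_add [simp]: "mdeg (\<mu> + \<nu>) = mdeg \<mu> + mdeg \<nu>"
  by (simp add: mdeg_def)

lemma polys_upto_iff: "f \<in> polys_upto k \<longleftrightarrow> (\<forall>\<mu>\<in>keys f. mdeg \<mu> \<le> k)"
  by (auto simp: polys_upto_def mdeg_def)

lemma finite_mdeg_le: "finite {\<mu>. mdeg \<mu> \<le> k}"
  by (rule finite_subset[of _ "{..k} \<times> {..k}"]) (simp_all add: mdeg_def subset_eq)

lemma polys_upto_0 [simp]: "0 \<in> polys_upto k"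
  by (simp add: polys_upto_iff)

lemma polys_upto_add: "f \<in> polys_upto k \<Longrightarrow> g \<in> polys_upto k \<Longrightarrow> f + g \<in> polys_upto k"
  unfolding polys_upto_iff using Poly_Mapping.keys_add[of f g] by blast

lemma polys_upto_diff: "f \<in> polys_upto k \<Longrightarrow> g \<in> polys_upto k \<Longrightarrow> f - g \<in> polys_upto k"
  unfolding polys_upto_iff using Poly_Mapping.keys_diff[of f g] by blast

lemma polys_upto_mult:
  assumes "f \<in> polys_upto j" "g \<in> polys_upto k"
  shows "f * g \<in> polys_upto (j + k)"
  unfolding polys_upto_iff
proof
  fix \<mu>
  assume "\<mu> \<in> keys (f * g)"
  then obtain a b where "\<mu> = a + b" "a \<in> keys f" "b \<in> keys g"
    using Poly_Mapping.keys_mult[of f g] by blast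
  then show "mdeg \<mu> \<le> j + k"
    using assms by (simp add: polys_upto_iff add_mono)
qed

lemma polys_upto_cst_mult: "f \<in> polys_upto k \<Longrightarrow> cst c * f \<in> polys_upto k"
  by (simp add: polys_upto_iff in_keys_iff lookup_cst_mult)

lemma polys_upto_mono: "f \<in> polys_upto j \<Longrightarrow> j \<le> k \<Longrightarrow> f \<in> polys_upto k"
  by (auto simp: polys_upto_iff)

lemma polys_upto_mon [simp]: "pmon \<mu> \<in> polys_upto k \<longleftrightarrow> mdeg \<mu> \<le> k"
  by (simp add: polys_upto_iff)

lemma polys_upto_sum: "(\<And>i. i \<in> A \<Longrightarrow> f i \<in> polys_upto k) \<Longrightarrow> sum f A \<in> polys_upto k"
  by (induction A rule: infinite_finite_induct) (auto intro: polys_upto_add)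

text \<open>The linear functional sending each monomial to its moment. Indexing the moments by
  exponent pairs turns multiplication by a monomial into a shift of the index.\<close>

definition riesz :: "(nat \<times> nat \<Rightarrow> real) \<Rightarrow> bipoly \<Rightarrow> real" where
  "riesz \<gamma> f = (\<Sum>\<kappa>\<in>keys f. lookup f \<kappa> * \<gamma> \<kappa>)"

lemma riesz_superset:
  assumes "finite A" "keys f \<subseteq> A"
  shows "riesz \<gamma> f = (\<Sum>\<kappa>\<in>A. lookup f \<kappa> * \<gamma> \<kappa>)"
  unfolding riesz_def using assms
  by (intro sum.mono_neutral_left) (auto simp: in_keys_iff)

lemma riesz_mon [simp]: "riesz \<gamma> (pmon \<mu>) = \<gamma> \<mu>"
  by (simp add: riesz_def)

interpretation riesz: bipoly_functional "riesz \<gamma>" for \<gamma>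
proof
  fix f g :: bipoly and c
  have "keys (f + g) \<subseteq> keys f \<union> keys g"
    by (rule Poly_Mapping.keys_add)
  then show "riesz \<gamma> (f + g) = riesz \<gamma> f + riesz \<gamma> g"
    by (simp add: riesz_superset[where A = "keys f \<union> keys g"] lookup_add distrib_right
        sum.distrib)
  have "keys (cst c * f) \<subseteq> keys f"
    by (auto simp: in_keys_iff lookup_cst_mult)
  then show "riesz \<gamma> (cst c * f) = c * riesz \<gamma> f"
    by (simp add: riesz_superset[where A = "keys f"] lookup_cst_mult sum_distrib_left mult.assoc)
qed

lemma riesz_mult_mon: "riesz \<gamma> (f * pmon \<nu>) = (\<Sum>\<kappa>\<in>keys f. lookup f \<kappa> * \<gamma> (\<kappa> + \<nu>))"
proof -
  have "f * pmon \<nu> = (\<Sum>\<kappa>\<in>keys f. cst (lookup f \<kappa>) * pmon (\<kappa> + \<nu>))"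
    using arg_cong[OF bipoly_expansion[of "keys f" f], of "\<lambda>g. g * pmon \<nu>"]
    by (simp add: sum_distrib_right mon_add mult.assoc)
  then show ?thesis
    by (simp only: riesz.L_sum riesz.L_cst riesz_mon)
qed

lemma riesz_cong:
  assumes "f \<in> polys_upto k" "\<And>\<mu>. mdeg \<mu> \<le> k \<Longrightarrow> \<gamma> \<mu> = \<delta> \<mu>"
  shows "riesz \<gamma> f = riesz \<delta> f"
  unfolding riesz_def using assms by (intro sum.cong) (auto simp: polys_upto_iff)

context bipoly_functional
begin

lemma L_mult_expansion: "L (f * h) = (\<Sum>\<nu>\<in>keys h. lookup h \<nu> * L (f * pmon \<nu>))"
proof -
  have "f * h = (\<Sum>\<nu>\<in>keys h. cst (lookup h \<nu>) * (f * pmon \<nu>))"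
    using arg_cong[OF bipoly_expansion[of "keys h" h], of "\<lambda>g. f * g"]
    by (simp add: sum_distrib_left mult.left_commute)
  then show ?thesis
    by (simp only: L_sum L_cst)
qed

lemma null_if_monomials: "(\<And>\<nu>. L (f * pmon \<nu>) = 0) \<Longrightarrow> f \<in> null"
  unfolding null_def by (subst mem_Collect_eq, subst L_mult_expansion) simp

lemma L_mult_eq_0_if_monomials:
  assumes "h \<in> polys_upto k" "\<And>\<nu>. mdeg \<nu> \<le> k \<Longrightarrow> L (f * pmon \<nu>) = 0"
  shows "L (f * h) = 0"
  using assms by (subst L_mult_expansion) (auto simp: polys_upto_iff intro!: sum.neutral)

end

section \<open>Extending moments along two coprime relations\<close>

text \<open>The relations are x^e1 = p and x^e2 = q in multi-index notation. Only \<open>p\<close>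
  must drop in degree; \<open>q\<close> may keep the degree of its leading monomial, and then the
  additive weight \<open>\<tau>\<close> breaks the tie. Stating everything through
  \<open>e1\<close>, \<open>e2\<close> and \<open>\<tau>\<close> covers both assignments of the
  roles to x and y.\<close>

locale moment_recursion =
  fixes K :: nat and e1 e2 :: "nat \<times> nat" and p q :: bipoly
    and \<tau> :: "nat \<times> nat \<Rightarrow> nat" and \<beta> :: "nat \<times> nat \<Rightarrow> real"
  assumes \<tau>_add: "\<tau> (\<mu> + \<nu>) = \<tau> \<mu> + \<tau> \<nu>"
    and p_lower: "\<kappa> \<in> keys p \<Longrightarrow> mdeg \<kappa> < mdeg e1"
    and q_lower: "\<kappa> \<in> keys q \<Longrightarrow> mdeg \<kappa> < mdeg e2 \<or> mdeg \<kappa> = mdeg e2 \<and> \<tau> \<kappa> < \<tau> e2"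
    and cover: "K < mdeg \<mu> \<Longrightarrow> (\<exists>\<nu>. \<mu> = e1 + \<nu>) \<or> (\<exists>\<nu>. \<mu> = e2 + \<nu>)"
    and coprime: "e2 + \<mu> = e1 + \<nu> \<Longrightarrow> \<exists>\<kappa>. \<mu> = e1 + \<kappa>"
    and low1: "mdeg (e1 + \<nu>) \<le> 2 * K \<Longrightarrow>
      \<beta> (e1 + \<nu>) = (\<Sum>\<kappa>\<in>keys p. lookup p \<kappa> * \<beta> (\<kappa> + \<nu>))"
    and low2: "mdeg (e2 + \<nu>) \<le> 2 * K \<Longrightarrow>
      \<beta> (e2 + \<nu>) = (\<Sum>\<kappa>\<in>keys q. lookup q \<kappa> * \<beta> (\<kappa> + \<nu>))"
    and psd: "f \<in> polys_upto K \<Longrightarrow> 0 \<le> riesz \<beta> (f * f)"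
begin

definition order :: "((nat \<times> nat) \<times> (nat \<times> nat)) set" where
  "order = inv_image (less_than <*lex*> less_than) (\<lambda>\<mu>. (mdeg \<mu>, \<tau> \<mu>))"

lemma wf_order: "wf order"
  by (auto simp: order_def)

lemma order_p: "\<kappa> \<in> keys p \<Longrightarrow> (\<kappa> + \<nu>, e1 + \<nu>) \<in> order"
  using p_lower by (simp add: order_def)

lemma order_q: "\<kappa> \<in> keys q \<Longrightarrow> (\<kappa> + \<nu>, e2 + \<nu>) \<in> order"
  using q_lower by (auto simp: order_def \<tau>_add)

lemma cover': "\<not> mdeg \<mu> \<le> 2 * K \<Longrightarrow> \<nexists>\<nu>. \<mu> = e1 + \<nu> \<Longrightarrow> \<exists>\<nu>. \<mu> = e2 + \<nu>"
  using cover[of \<mu>] by auto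

text \<open>Where both relations apply, the first has priority, so the first recurrence holds by
  construction and the second has to be proved. In the last branch \<open>cover'\<close> guarantees
  divisibility by the second leading monomial. Hence both componentwise differences of exponents are
  exact.\<close>

function ext :: "nat \<times> nat \<Rightarrow> real" where
  "ext \<mu> = (if mdeg \<mu> \<le> 2 * K then \<beta> \<mu>
     else if \<exists>\<nu>. \<mu> = e1 + \<nu> then \<Sum>\<kappa>\<in>keys p. lookup p \<kappa> * ext (\<kappa> + (\<mu> - e1))
     else \<Sum>\<kappa>\<in>keys q. lookup q \<kappa> * ext (\<kappa> + (\<mu> - e2)))"
  by auto
termination
proof (relation order)
  show "wf order"
    by (rule wf_order)
next
  fix \<mu> \<kappa>
  assume "\<exists>\<nu>. \<mu> = e1 + \<nu>" "\<kappa> \<in> keys p"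
  then obtain \<nu> where "\<mu> = e1 + \<nu>"
    by blast
  with \<open>\<kappa> \<in> keys p\<close> show "(\<kappa> + (\<mu> - e1), \<mu>) \<in> order"
    using order_p[of \<kappa> \<nu>] by simp
next
  fix \<mu> \<kappa>
  assume "\<not> mdeg \<mu> \<le> 2 * K" "\<nexists>\<nu>. \<mu> = e1 + \<nu>" "\<kappa> \<in> keys q"
  moreover from this obtain \<nu> where "\<mu> = e2 + \<nu>"
    using cover'[of \<mu>] by blast
  ultimately show "(\<kappa> + (\<mu> - e2), \<mu>) \<in> order"
    using order_q[of \<kappa> \<nu>] by simp
qed

declare ext.simps [simp del]

lemma ext_low: "mdeg \<mu> \<le> 2 * K \<Longrightarrow> ext \<mu> = \<beta> \<mu>"
  by (simp add: ext.simps)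

lemma ext_e1: "ext (e1 + \<nu>) = (\<Sum>\<kappa>\<in>keys p. lookup p \<kappa> * ext (\<kappa> + \<nu>))"
proof (cases "mdeg (e1 + \<nu>) \<le> 2 * K")
  case True
  have "(\<Sum>\<kappa>\<in>keys p. lookup p \<kappa> * ext (\<kappa> + \<nu>)) = (\<Sum>\<kappa>\<in>keys p. lookup p \<kappa> * \<beta> (\<kappa> + \<nu>))"
    using p_lower True by (intro sum.cong refl arg_cong2[where f = "(*)"] ext_low) fastforce
  then show ?thesis
    using low1[OF True] True by (simp add: ext_low)
next
  case False
  then show ?thesis
    by (subst ext.simps) auto
qed

text \<open>This is the consistency of the two recurrences. If both leading monomials divide the
  exponent, coprimality gives \<open>\<nu> = e1 + \<nu>'\<close>. Rewriting by the first relation,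
  then by the second, and folding back by the first yields the claim. The induction on the degree of
  \<open>\<nu>\<close> works since \<open>p\<close> is strictly lower in degree than
  \<open>e1\<close>.\<close>

lemma ext_e2: "ext (e2 + \<nu>) = (\<Sum>\<kappa>\<in>keys q. lookup q \<kappa> * ext (\<kappa> + \<nu>))"
proof (induction "mdeg \<nu>" arbitrary: \<nu> rule: less_induct)
  case less
  show ?case
  proof (cases "mdeg (e2 + \<nu>) \<le> 2 * K")
    case True
    have "(\<Sum>\<kappa>\<in>keys q. lookup q \<kappa> * ext (\<kappa> + \<nu>)) = (\<Sum>\<kappa>\<in>keys q. lookup q \<kappa> * \<beta> (\<kappa> + \<nu>))"
      using q_lower True by (intro sum.cong refl arg_cong2[where f = "(*)"] ext_low) fastforce
    then show ?thesis
      using low2[OF True] True by (simp add: ext_low)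
  next
    case high: False
    show ?thesis
    proof (cases "\<exists>\<kappa>. e2 + \<nu> = e1 + \<kappa>")
      case False
      with high show ?thesis
        by (subst ext.simps) auto
    next
      case True
      then obtain \<nu>' where \<nu>: "\<nu> = e1 + \<nu>'"
        using coprime by blast
      have IH: "ext (e2 + (\<kappa> + \<nu>')) = (\<Sum>l\<in>keys q. lookup q l * ext (l + (\<kappa> + \<nu>')))"
        if "\<kappa> \<in> keys p" for \<kappa>
        using p_lower[OF that] \<nu> by (intro less) simp
      have "ext (e2 + \<nu>) = (\<Sum>\<kappa>\<in>keys p. lookup p \<kappa> * ext (e2 + (\<kappa> + \<nu>')))"
        using ext_e1[of "e2 + \<nu>'"] \<nu> by (simp add: add_ac)
      also have "\<dots> = (\<Sum>\<kappa>\<in>keys p. \<Sum>l\<in>keys q. lookup p \<kappa> * (lookup q l * ext (l + (\<kappa> + \<nu>'))))"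
        by (simp add: IH sum_distrib_left)
      also have "\<dots> = (\<Sum>l\<in>keys q. \<Sum>\<kappa>\<in>keys p. lookup p \<kappa> * (lookup q l * ext (l + (\<kappa> + \<nu>'))))"
        by (rule sum.swap)
      also have "\<dots> = (\<Sum>l\<in>keys q. lookup q l * (\<Sum>\<kappa>\<in>keys p. lookup p \<kappa> * ext (\<kappa> + (l + \<nu>'))))"
        by (simp add: sum_distrib_left mult.left_commute add.left_commute)
      also have "\<dots> = (\<Sum>l\<in>keys q. lookup q l * ext (l + \<nu>))"
        using ext_e1[of "l + \<nu>'" for l] by (simp add: \<nu> add.left_commute)
      finally show ?thesis .
    qed
  qed
qed

section \<open>Reduction modulo the null ideal of the extended functional\<close>

abbreviation N :: "bipoly set" where
  "N \<equiv> riesz.null ext"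

lemma e1_null: "pmon e1 - p \<in> N"
  by (rule riesz.null_if_monomials)
    (simp add: left_diff_distrib riesz.L_diff riesz_mult_mon ext_e1)

lemma e2_null: "pmon e2 - q \<in> N"
  by (rule riesz.null_if_monomials)
    (simp add: left_diff_distrib riesz.L_diff riesz_mult_mon ext_e2)

lemma reduce_step:
  assumes g: "pmon e - g \<in> N"
    and red: "\<And>\<kappa>. \<kappa> \<in> keys g \<Longrightarrow> \<exists>r\<in>polys_upto K. pmon (\<kappa> + \<nu>) - r \<in> N"
  shows "\<exists>r\<in>polys_upto K. pmon (e + \<nu>) - r \<in> N"
proof -
  obtain r where r: "\<And>\<kappa>. \<kappa> \<in> keys g \<Longrightarrow> r \<kappa> \<in> polys_upto K"
      "\<And>\<kappa>. \<kappa> \<in> keys g \<Longrightarrow> pmon (\<kappa> + \<nu>) - r \<kappa> \<in> N"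
    using red by metis
  let ?r = "\<Sum>\<kappa>\<in>keys g. cst (lookup g \<kappa>) * r \<kappa>"
  have "pmon \<nu> * (pmon e - g) + (\<Sum>\<kappa>\<in>keys g. cst (lookup g \<kappa>) * (pmon (\<kappa> + \<nu>) - r \<kappa>)) \<in> N"
    by (intro riesz.null_add riesz.null_sum riesz.null_mult g r)
  moreover have "g * pmon \<nu> = (\<Sum>\<kappa>\<in>keys g. cst (lookup g \<kappa>) * pmon (\<kappa> + \<nu>))"
    using arg_cong[OF bipoly_expansion[of "keys g" g], of "\<lambda>g. g * pmon \<nu>"]
    by (simp add: sum_distrib_right mon_add mult.assoc)
  ultimately have "pmon (e + \<nu>) - ?r \<in> N"
    by (simp add: right_diff_distrib sum_subtractf mon_add mult_ac)
  moreover have "?r \<in> polys_upto K"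
    by (intro polys_upto_sum polys_upto_cst_mult r)
  ultimately show ?thesis
    by blast
qed

text \<open>Rewriting by the two relations terminates as \<open>order\<close> is well-founded, and
  it can only stop at degree at most \<open>K\<close>, by \<open>cover\<close>.\<close>

lemma reduce_mon: "\<exists>r\<in>polys_upto K. pmon \<mu> - r \<in> N"
proof (induction \<mu> rule: wf_induct_rule[OF wf_order])
  case (1 \<mu>)
  show ?case
  proof (cases "mdeg \<mu> \<le> K")
    case True
    then show ?thesis
      by (intro bexI[of _ "pmon \<mu>"]) simp_all
  next
    case False
    then have "K < mdeg \<mu>"
      by simp
    then consider \<nu> where "\<mu> = e1 + \<nu>" | \<nu> where "\<mu> = e2 + \<nu>"
      using cover[of \<mu>] by blast
    then show ?thesis
    proof cases
      case (1 \<nu>)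
      then show ?thesis
        using reduce_step[OF e1_null] "1.IH" order_p by blast
    next
      case (2 \<nu>)
      then show ?thesis
        using reduce_step[OF e2_null] "1.IH" order_q by blast
    qed
  qed
qed

lemma reduce: "\<exists>r\<in>polys_upto K. f - r \<in> N"
proof -
  obtain r where r: "\<And>\<mu>. r \<mu> \<in> polys_upto K" "\<And>\<mu>. pmon \<mu> - r \<mu> \<in> N"
    using reduce_mon by metis
  let ?r = "\<Sum>\<kappa>\<in>keys f. cst (lookup f \<kappa>) * r \<kappa>"
  have "(\<Sum>\<kappa>\<in>keys f. cst (lookup f \<kappa>) * (pmon \<kappa> - r \<kappa>)) \<in> N"
    by (intro riesz.null_sum riesz.null_mult r)
  then have "f - ?r \<in> N"
    using bipoly_expansion[of "keys f" f, symmetric]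
    by (simp only: right_diff_distrib sum_subtractf finite_keys subset_refl)
  moreover have "?r \<in> polys_upto K"
    by (intro polys_upto_sum polys_upto_cst_mult r)
  ultimately show ?thesis
    by blast
qed

text \<open>Replacing \<open>f\<close> by its reduction \<open>r\<close> does not change the value
  on the square, and r^2 has degree at most 2 K, where the moments are those of the given positive
  functional.\<close>

lemma ext_psd: "0 \<le> riesz ext (f * f)"
proof -
  obtain r where r: "r \<in> polys_upto K" "f - r \<in> N"
    using reduce[of f] by blast
  have "riesz ext ((f + r) * (f - r)) = 0"
    by (rule riesz.nullD[OF riesz.null_mult[OF r(2)]])
  moreover have "(f + r) * (f - r) = f * f - r * r"
    by (simp add: algebra_simps)
  ultimately have "riesz ext (f * f) = riesz ext (r * r)"
    by (simp add: riesz.L_diff)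
  also have "\<dots> = riesz \<beta> (r * r)"
    using polys_upto_mult[OF r(1) r(1)] by (intro riesz_cong[of _ "2 * K"] ext_low) (simp_all add: mult_2)
  finally show ?thesis
    using psd[OF r(1)] by simp
qed

text \<open>The powers of \<open>z\<close> reduce to polynomials of degree at most \<open>K\<close>,
  a space of finite dimension, so they are linearly dependent modulo the null ideal.\<close>

lemma null_upoly: "\<exists>a. a \<noteq> 0 \<and> upoly_eval z a \<in> N"
proof -
  obtain r where r: "\<And>i. r i \<in> polys_upto K" "\<And>i. z ^ i - r i \<in> N"
    using reduce[of "z ^ i" for i] by metis
  let ?B = "{\<mu>. mdeg \<mu> \<le> K}"
  \<comment> \<open>The exponents from 0 to \<open>card ?B\<close> number one more than the
    monomials in \<open>?B\<close>.\<close>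
  have "\<exists>c. (\<exists>i\<in>{..card ?B}. c i \<noteq> 0) \<and>
      (\<forall>\<mu>\<in>?B. (\<Sum>i\<le>card ?B. c i * lookup (r i) \<mu>) = 0)"
    by (rule nontrivial_linear_relation) (simp_all add: finite_mdeg_le)
  then obtain c i where i: "i \<le> card ?B" "c i \<noteq> 0"
      and c: "\<And>\<mu>. mdeg \<mu> \<le> K \<Longrightarrow> (\<Sum>i\<le>card ?B. c i * lookup (r i) \<mu>) = 0"
    by auto
  have rel: "(\<Sum>i\<le>card ?B. cst (c i) * r i) = 0"
  proof (rule poly_mapping_eqI)
    fix \<mu>
    show "lookup (\<Sum>i\<le>card ?B. cst (c i) * r i) \<mu> = lookup 0 \<mu>"
    proof (cases "mdeg \<mu> \<le> K")
      case True
      then show ?thesis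
        using c by (simp add: lookup_sum lookup_cst_mult)
    next
      case False
      then have "lookup (r i) \<mu> = 0" for i
        using r(1)[of i] by (auto simp: polys_upto_iff in_keys_iff)
      then show ?thesis
        by (simp add: lookup_sum lookup_cst_mult)
    qed
  qed
  define a where "a = (\<Sum>i\<le>card ?B. Polynomial.monom (c i) i)"
  have "Polynomial.coeff a i = c i"
    using i by (simp add: a_def coeff_sum sum.delta')
  then have "a \<noteq> 0"
    using i by auto
  moreover have "(\<Sum>i\<le>card ?B. cst (c i) * (z ^ i - r i)) \<in> N"
    by (intro riesz.null_sum riesz.null_mult r)
  then have "upoly_eval z a \<in> N"
    using rel by (simp add: a_def upoly_eval_sum upoly_eval_monom right_diff_distrib sum_subtractf)
  ultimately show ?thesis
    by blast
qed

sublocale ext: psd_functional "riesz ext"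
  by standard (rule ext_psd)

lemma atomic_moments:
  "\<exists>W w. finite W \<and> (\<forall>p\<in>W. 0 \<le> w p) \<and>
    (\<forall>i j. i + j \<le> 2 * K \<longrightarrow> \<beta> (i, j) = (\<Sum>p\<in>W. w p * (fst p ^ i * snd p ^ j)))"
proof -
  have x: "bmonom 1 0 ^ i = bmonom i 0" and y: "bmonom 0 1 ^ i = bmonom 0 i" for i
    by (induction i) (simp_all add: mult_single single_one[symmetric] zero_prod_def del: single_one)
  obtain a b where ab: "a \<noteq> 0" "upoly_eval (bmonom 1 0) a \<in> N"
      "b \<noteq> 0" "upoly_eval (bmonom 0 1) b \<in> N"
    using null_upoly by metis
  have moments: "riesz ext (bmonom 1 0 ^ i * bmonom 0 1 ^ j) = \<beta> (i, j)" if "i + j \<le> 2 * K" for i j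
    unfolding x y using ext_low[of "(i, j)"] that by (simp add: mult_single mdeg_def)
  obtain W w where "finite W \<and> (\<forall>p\<in>W. 0 \<le> w p) \<and>
      (\<forall>i j. riesz ext (bmonom 1 0 ^ i * bmonom 0 1 ^ j) = (\<Sum>p\<in>W. w p * (fst p ^ i * snd p ^ j)))"
    using ext.finite_atomic_representation[OF ab] by (elim exE) (rule that)
  with moments show ?thesis
    by (intro exI[of _ W] exI[of _ w]) simp
qed

end

text \<open>The point measure lives on the subsets of \<open>W\<close>; pushing it forward along the
  identity makes it a Borel measure on the plane.\<close>

lemma representing_measure_atomic:
  fixes W :: "(real \<times> real) set"
  assumes "finite W" "\<forall>p\<in>W. 0 \<le> w p"
    and "\<And>i j. i + j \<le> 2 * d \<Longrightarrow> \<beta> i j = (\<Sum>p\<in>W. w p * (fst p ^ i * snd p ^ j))"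
  shows "representing_measure d \<beta> (distr (point_measure W (\<lambda>p. ennreal (w p))) borel id)"
  unfolding representing_measure_def
proof (intro conjI allI impI)
  fix i j :: nat
  assume "i + j \<le> 2 * d"
  let ?f = "\<lambda>(x, y). x ^ i * y ^ j :: real"
  let ?M = "point_measure W (\<lambda>p. ennreal (w p))"
  have f: "?f \<in> borel_measurable borel"
    by (intro borel_measurable_continuous_onI) (auto simp: case_prod_unfold intro!: continuous_intros)
  have id: "id \<in> measurable ?M borel"
    by simp
  have "integrable (distr ?M borel id) ?f"
    using integrable_point_measure_finite[OF assms(1)] by (simp add: integrable_distr_eq[OF id f])
  moreover have "integral\<^sup>L (distr ?M borel id) ?f = (\<Sum>p\<in>W. w p * (fst p ^ i * snd p ^ j))"
    unfolding integral_distr[OF id f] using assms(1,2)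
    by (simp add: lebesgue_integral_point_measure_finite case_prod_unfold)
  ultimately show "has_bochner_integral (distr ?M borel id) ?f (\<beta> i j)"
    using assms(3)[OF \<open>i + j \<le> 2 * d\<close>] by (simp add: has_bochner_integral_iff)
qed simp

section \<open>Moment matrices\<close>

lemma set_monoms_upto: "set (monoms_upto k) = {\<mu>. mdeg \<mu> \<le> k}"
proof (rule Set.set_eqI, clarify)
  fix i j
  show "(i, j) \<in> set (monoms_upto k) \<longleftrightarrow> (i, j) \<in> {\<mu>. mdeg \<mu> \<le> k}"
    by (auto simp: monoms_upto_def mdeg_def image_iff intro: bexI[of _ "i + j"])
qed

lemma distinct_monoms_upto: "distinct (monoms_upto k)"
proof (induction k)
  case 0
  show ?case
    by (simp add: monoms_upto_def)
next
  case (Suc k)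
  let ?new = "map (\<lambda>j. (Suc k - j, j)) [0..<Suc (Suc k)]"
  have "monoms_upto (Suc k) = monoms_upto k @ ?new"
    by (simp add: monoms_upto_def)
  moreover have "distinct ?new"
    unfolding distinct_map by (auto intro: inj_onI)
  moreover have "set (monoms_upto k) \<inter> set ?new = {}"
    by (auto simp: set_monoms_upto mdeg_def)
  ultimately show ?case
    using Suc by simp
qed

text \<open>Replaces positions in the monomial list by exponents, so that the order of the list no
  longer matters in sums.\<close>

lemma sum_monoms_upto:
  "(\<Sum>r\<in>{0..<length (monoms_upto k)}. g (monoms_upto k ! r)) = (\<Sum>\<mu> | mdeg \<mu> \<le> k. g \<mu>)"
proof -
  have "bij_betw ((!) (monoms_upto k)) {0..<length (monoms_upto k)} {\<mu>. mdeg \<mu> \<le> k}"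
    using bij_betw_nth[OF distinct_monoms_upto refl refl, of k]
    by (simp add: set_monoms_upto lessThan_atLeast0)
  then show ?thesis
    by (rule sum.reindex_bij_betw)
qed

lemma dim_column_eval [simp]: "dim_vec (column_eval k \<beta> f) = length (monoms_upto k)"
  by (simp add: column_eval_def moment_matrix_def)

text \<open>The entry of f(X,Y) in row x^\<mu> is L (f x^\<mu>). The degree bound ensures that
  \<open>coeff_vec\<close> records all coefficients of \<open>f\<close>.\<close>

lemma column_eval_index:
  assumes "f \<in> polys_upto k" "r < length (monoms_upto k)"
  shows "vec_index (column_eval k \<beta> f) r = riesz (case_prod \<beta>) (f * pmon (monoms_upto k ! r))"
proof -
  let ?m = "\<lambda>r. monoms_upto k ! r"
  have "vec_index (column_eval k \<beta> f) r =
      (\<Sum>c\<in>{0..<length (monoms_upto k)}. lookup f (?m c) * case_prod \<beta> (?m c + ?m r))"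
    using assms(2) unfolding column_eval_def moment_matrix_def coeff_vec_def
    by (auto simp: scalar_prod_def case_prod_unfold add.commute mult.commute intro!: sum.cong)
  also have "\<dots> = (\<Sum>\<mu> | mdeg \<mu> \<le> k. lookup f \<mu> * case_prod \<beta> (\<mu> + ?m r))"
    by (rule sum_monoms_upto)
  also have "\<dots> = riesz (case_prod \<beta>) (f * pmon (?m r))"
    unfolding riesz_mult_mon using assms(1)
    by (intro sum.mono_neutral_right) (auto simp: finite_mdeg_le polys_upto_iff in_keys_iff)
  finally show ?thesis .
qed

lemma monoms_upto_nth_exhaust:
  assumes "mdeg \<mu> \<le> k"
  obtains r where "r < length (monoms_upto k)" "monoms_upto k ! r = \<mu>"
  using assms set_monoms_upto[of k] by (metis in_set_conv_nth mem_Collect_eq)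

lemma column_eval_eq_iff:
  assumes "f \<in> polys_upto k" "g \<in> polys_upto k"
  shows "column_eval k \<beta> f = column_eval k \<beta> g \<longleftrightarrow>
    (\<forall>\<mu>. mdeg \<mu> \<le> k \<longrightarrow> riesz (case_prod \<beta>) ((f - g) * pmon \<mu>) = 0)" (is "?L \<longleftrightarrow> ?R")
proof
  assume ?L
  show ?R
  proof (intro allI impI)
    fix \<mu>
    assume "mdeg \<mu> \<le> k"
    then obtain r where "r < length (monoms_upto k)" "monoms_upto k ! r = \<mu>"
      by (rule monoms_upto_nth_exhaust)
    with \<open>?L\<close> show "riesz (case_prod \<beta>) ((f - g) * pmon \<mu>) = 0"
      using column_eval_index[OF assms(1), of r \<beta>] column_eval_index[OF assms(2), of r \<beta>]
      by (simp add: left_diff_distrib riesz.L_diff)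
  qed
next
  assume R: ?R
  show ?L
  proof (rule eq_vecI)
    fix r
    assume "r < dim_vec (column_eval k \<beta> g)"
    then have r: "r < length (monoms_upto k)"
      by simp
    then have "mdeg (monoms_upto k ! r) \<le> k"
      using set_monoms_upto[of k] nth_mem by blast
    with R have "riesz (case_prod \<beta>) ((f - g) * pmon (monoms_upto k ! r)) = 0"
      by blast
    then show "vec_index (column_eval k \<beta> f) r = vec_index (column_eval k \<beta> g) r"
      using r assms by (simp add: column_eval_index left_diff_distrib riesz.L_diff)
  qed simp
qed

lemma column_eval_0: "column_eval k \<beta> 0 = 0\<^sub>v (length (monoms_upto k))"
  by (rule eq_vecI) (simp_all add: column_eval_index)

lemma column_eval_eq_0_iff:
  assumes "f \<in> polys_upto k"
  shows "column_eval k \<beta> f = 0\<^sub>v (length (monoms_upto k)) \<longleftrightarrow>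
    (\<forall>\<mu>. mdeg \<mu> \<le> k \<longrightarrow> riesz (case_prod \<beta>) (f * pmon \<mu>) = 0)"
  using column_eval_eq_iff[OF assms polys_upto_0, of \<beta>] by (simp add: column_eval_0)

lemma riesz_square_nonneg:
  assumes "positive_semidefinite (moment_matrix k \<beta>)" "f \<in> polys_upto k"
  shows "0 \<le> riesz (case_prod \<beta>) (f * f)"
proof -
  let ?L = "riesz (case_prod \<beta>)" and ?v = "coeff_vec k f"
  have "?v \<in> carrier_vec (dim_row (moment_matrix k \<beta>))"
    by (simp add: moment_matrix_def coeff_vec_def)
  then have "0 \<le> scalar_prod ?v (column_eval k \<beta> f)"
    using assms(1) by (simp add: positive_semidefinite_def column_eval_def)
  also have "scalar_prod ?v (column_eval k \<beta> f) = (\<Sum>r\<in>{0..<length (monoms_upto k)}.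
      lookup f (monoms_upto k ! r) * ?L (f * pmon (monoms_upto k ! r)))"
    using assms(2) by (auto simp: scalar_prod_def coeff_vec_def column_eval_index intro!: sum.cong)
  also have "\<dots> = (\<Sum>\<mu> | mdeg \<mu> \<le> k. lookup f \<mu> * ?L (f * pmon \<mu>))"
    by (rule sum_monoms_upto)
  also have "\<dots> = ?L (f * f)"
    unfolding riesz.L_mult_expansion[of _ f f] using assms(2)
    by (intro sum.mono_neutral_right) (auto simp: finite_mdeg_le polys_upto_iff in_keys_iff)
  finally show ?thesis .
qed

section \<open>Propagation of column relations\<close>

lemma mdeg_split:
  assumes "mdeg \<mu> \<le> a + b"
  obtains \<nu> \<nu>' where "\<mu> = \<nu> + \<nu>'" "mdeg \<nu> \<le> a" "mdeg \<nu>' \<le> b"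
proof (cases "fst \<mu> \<le> a")
  case True
  then show ?thesis
    using that[of "(fst \<mu>, min (snd \<mu>) (a - fst \<mu>))" "(0, snd \<mu> - min (snd \<mu>) (a - fst \<mu>))"] assms
    by (auto simp: mdeg_def prod_eq_iff)
next
  case False
  then show ?thesis
    using that[of "(a, 0)" "(fst \<mu> - a, snd \<mu>)"] assms by (auto simp: mdeg_def prod_eq_iff)
qed

text \<open>By positivity, L (f^2) = 0 already forces f(X,Y) = 0. Split the monomial into a factor
  of degree at most k - m, absorbed into the column by recursive generation, and one of degree at
  most k, which is read off as a row.\<close>

lemma riesz_relation_multiple:
  assumes psd: "positive_semidefinite (moment_matrix k \<beta>)" and rg: "recursively_generated k \<beta>"
    and f: "f \<in> polys_upto m" "m \<le> k" "riesz (case_prod \<beta>) (f * f) = 0"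
    and deg: "m + mdeg \<mu> \<le> 2 * k"
  shows "riesz (case_prod \<beta>) (f * pmon \<mu>) = 0"
proof -
  have fk: "f \<in> polys_upto k"
    using f polys_upto_mono by blast
  have "riesz (case_prod \<beta>) (f * pmon \<nu>) = 0" if "mdeg \<nu> \<le> k" for \<nu>
  proof (rule riesz.cross_zero_if_square_zero[OF _ f(3)])
    fix t
    have "pmon \<nu> + cst t * f \<in> polys_upto k"
      using fk that by (simp add: polys_upto_add polys_upto_cst_mult)
    then show "0 \<le> riesz (case_prod \<beta>) ((pmon \<nu> + cst t * f) * (pmon \<nu> + cst t * f))"
      by (rule riesz_square_nonneg[OF psd])
  qed
  then have col: "column_eval k \<beta> f = 0\<^sub>v (length (monoms_upto k))"
    using fk by (simp add: column_eval_eq_0_iff)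
  have "mdeg \<mu> \<le> (k - m) + k"
    using deg f(2) by simp
  then obtain \<nu> \<nu>' where \<nu>: "\<mu> = \<nu> + \<nu>'" "mdeg \<nu> \<le> k - m" "mdeg \<nu>' \<le> k"
    by (rule mdeg_split)
  have "pmon \<nu> \<in> polys_upto (k - m)" "pmon \<nu> \<in> polys_upto k"
    using \<nu>(2) by simp_all
  moreover from this have "f * pmon \<nu> \<in> polys_upto k"
    using polys_upto_mult[OF f(1), of "pmon \<nu>" "k - m"] f(2) by simp
  ultimately have "column_eval k \<beta> (f * pmon \<nu>) = 0\<^sub>v (length (monoms_upto k))"
    using rg fk col unfolding recursively_generated_def by blast
  then have "riesz (case_prod \<beta>) (f * pmon \<nu> * pmon \<nu>') = 0"
    using \<open>f * pmon \<nu> \<in> polys_upto k\<close> \<nu>(3)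
    by (simp add: column_eval_eq_0_iff del: split_paired_All)
  then show ?thesis
    by (simp add: \<nu>(1) mon_add mult.assoc)
qed

text \<open>Positivity and recursive generation supply the recurrences \<open>low1\<close>,
  \<open>low2\<close> and the condition \<open>psd\<close>; the remaining locale assumptions concern
  exponents only.\<close>

lemma moment_recursion_if_psd:
  assumes psd: "positive_semidefinite (moment_matrix K \<beta>)" and rg: "recursively_generated K \<beta>"
    and deg: "mdeg e1 \<le> K" "mdeg e2 \<le> K"
    and rel: "riesz (case_prod \<beta>) ((pmon e1 - p) * (pmon e1 - p)) = 0"
      "riesz (case_prod \<beta>) ((pmon e2 - q) * (pmon e2 - q)) = 0"
    and \<tau>: "\<And>\<mu> \<nu>. \<tau> (\<mu> + \<nu>) = \<tau> \<mu> + \<tau> \<nu>"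
    and p: "\<And>\<kappa>. \<kappa> \<in> keys p \<Longrightarrow> mdeg \<kappa> < mdeg e1"
    and q: "\<And>\<kappa>. \<kappa> \<in> keys q \<Longrightarrow> mdeg \<kappa> < mdeg e2 \<or> mdeg \<kappa> = mdeg e2 \<and> \<tau> \<kappa> < \<tau> e2"
    and cover: "\<And>\<mu>. K < mdeg \<mu> \<Longrightarrow> (\<exists>\<nu>. \<mu> = e1 + \<nu>) \<or> (\<exists>\<nu>. \<mu> = e2 + \<nu>)"
    and coprime: "\<And>\<mu> \<nu>. e2 + \<mu> = e1 + \<nu> \<Longrightarrow> \<exists>\<kappa>. \<mu> = e1 + \<kappa>"
  shows "moment_recursion K e1 e2 p q \<tau> (case_prod \<beta>)"
proof
  have low: "case_prod \<beta> (e + \<nu>) = (\<Sum>\<kappa>\<in>keys g. lookup g \<kappa> * case_prod \<beta> (\<kappa> + \<nu>))"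
    if "mdeg e \<le> K" "g \<in> polys_upto (mdeg e)" "mdeg (e + \<nu>) \<le> 2 * K"
      "riesz (case_prod \<beta>) ((pmon e - g) * (pmon e - g)) = 0" for e g \<nu>
  proof -
    have "pmon e - g \<in> polys_upto (mdeg e)"
      using that by (simp add: polys_upto_diff)
    then have "riesz (case_prod \<beta>) ((pmon e - g) * pmon \<nu>) = 0"
      by (rule riesz_relation_multiple[OF psd rg]) (use that in simp_all)
    then show ?thesis
      unfolding left_diff_distrib riesz.L_diff riesz_mult_mon[of _ g]
      unfolding mon_add[symmetric] riesz_mon by simp
  qed
  fix \<nu>
  show "case_prod \<beta> (e1 + \<nu>) = (\<Sum>\<kappa>\<in>keys p. lookup p \<kappa> * case_prod \<beta> (\<kappa> + \<nu>))"
    if "mdeg (e1 + \<nu>) \<le> 2 * K"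
    using p by (intro low rel(1) deg that) (simp add: polys_upto_iff less_imp_le)
  show "case_prod \<beta> (e2 + \<nu>) = (\<Sum>\<kappa>\<in>keys q. lookup q \<kappa> * case_prod \<beta> (\<kappa> + \<nu>))"
    if "mdeg (e2 + \<nu>) \<le> 2 * K"
    using q by (intro low rel(2) deg that) (fastforce simp: polys_upto_iff)
qed (use assms(7-) riesz_square_nonneg[OF psd] in blast)+

theorem mainTheorem5:
  fixes d :: nat and \<beta> :: "nat \<Rightarrow> nat \<Rightarrow> real"
  assumes "d \<ge> 1"
    and "positive_semidefinite (moment_matrix d \<beta>)"
    and "recursively_generated d \<beta>"
    and "recursively_determinate d \<beta>"
    and "\<exists>B :: nat \<Rightarrow> nat \<Rightarrow> nat \<Rightarrow> real. B d = \<beta> \<and>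
      (\<forall>k \<in> {d + 1..2 * d - 1}.
         extends_moments (k - 1) (B (k - 1)) (B k) \<and>
         positive_semidefinite (moment_matrix k (B k)) \<and>
         recursively_generated k (B k))"
  shows "\<exists>\<mu>. representing_measure d \<beta> \<mu>"
proof -
  obtain B where B0: "B d = \<beta>" and B: "\<And>k. k \<in> {d + 1..2 * d - 1} \<Longrightarrow>
      extends_moments (k - 1) (B (k - 1)) (B k) \<and>
      positive_semidefinite (moment_matrix k (B k)) \<and> recursively_generated k (B k)"
    using assms(5) by blast
  define K where "K = 2 * d - 1"
  define \<alpha> where "\<alpha> = B K"
  have K: "d \<le> K" "2 * d \<le> K + 1"
    using assms(1) by (simp_all add: K_def)
  \<comment> \<open>For d = 1 one has K = d and the list of extensions is empty, so the properties
    come from M_d itself.\<close>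
  have psd: "positive_semidefinite (moment_matrix K \<alpha>)" and rg: "recursively_generated K \<alpha>"
    using B[of K] B0 K assms(2,3) by (cases "K = d"; simp add: K_def \<alpha>_def)+
  have "\<forall>i j. i + j \<le> 2 * d \<longrightarrow> B k i j = \<beta> i j" if "d \<le> k" "k \<le> K" for k
    using that
  proof (induction k rule: dec_induct)
    case base
    then show ?case
      by (simp add: B0)
  next
    case (step k)
    then have "extends_moments k (B k) (B (Suc k))"
      using B[of "Suc k"] by (simp add: K_def)
    with step show ?case
      by (simp add: extends_moments_def)
  qed
  then have \<alpha>: "\<alpha> i j = \<beta> i j" if "i + j \<le> 2 * d" for i j
    using that K by (simp add: \<alpha>_def)
  \<comment> \<open>A relation of M_d passes to M_K through the square of its polynomial: this has
    degree at most 2 d, where the moments agree, and positivity of M_K recovers the relation from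
    it.\<close>
  have square: "riesz (case_prod \<alpha>) ((pmon e - g) * (pmon e - g)) = 0"
    if "column_eval d \<beta> (pmon e) = column_eval d \<beta> g" "mdeg e \<le> d" "g \<in> polys_upto d" for e g
  proof -
    have f: "pmon e - g \<in> polys_upto d"
      using that by (simp add: polys_upto_diff)
    have "riesz (case_prod \<beta>) ((pmon e - g) * (pmon e - g)) = 0"
      using that by (intro riesz.L_mult_eq_0_if_monomials[OF f])
      (simp add: column_eval_eq_iff del: split_paired_All)
    moreover have "(pmon e - g) * (pmon e - g) \<in> polys_upto (2 * d)"
      using polys_upto_mult[OF f f] by (simp add: mult_2)
    ultimately show ?thesis
      using riesz_cong[of _ "2 * d" "case_prod \<alpha>" "case_prod \<beta>"] \<alpha>
      by (simp add: mdeg_def case_prod_unfold)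
  qed
  obtain n m p q where nm: "1 \<le> n" "n \<le> d" "1 \<le> m" "m \<le> d"
    and rel: "column_eval d \<beta> (bmonom n 0) = column_eval d \<beta> p"
      "column_eval d \<beta> (bmonom 0 m) = column_eval d \<beta> q"
    and pq: "p \<in> polys_upto (n - 1) \<and> q \<in> polys_upto m \<and> lookup q (0, m) = 0 \<or>
      q \<in> polys_upto (m - 1) \<and> p \<in> polys_upto n \<and> lookup p (n, 0) = 0"
    using assms(4) unfolding recursively_determinate_def by blast
  have "p \<in> polys_upto d" "q \<in> polys_upto d"
    using pq nm by (auto elim!: polys_upto_mono)
  with rel nm have sq: "riesz (case_prod \<alpha>) ((bmonom n 0 - p) * (bmonom n 0 - p)) = 0"
      "riesz (case_prod \<alpha>) ((bmonom 0 m - q) * (bmonom 0 m - q)) = 0"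
    by (auto intro!: square simp: mdeg_def)
  have div: "(\<exists>\<nu>. \<mu> = (n, 0) + \<nu>) \<longleftrightarrow> n \<le> fst \<mu>" "(\<exists>\<nu>. \<mu> = (0, m) + \<nu>) \<longleftrightarrow> m \<le> snd \<mu>" for \<mu>
    by (cases \<mu>; auto simp: le_iff_add)+
  have deg: "mdeg (n, 0) \<le> K" "mdeg (0, m) \<le> K"
    using nm K by (simp_all add: mdeg_def)
  \<comment> \<open>A monomial divisible by neither x^n nor y^m has degree at most (n - 1) + (m -
    1), which is at most 2 d - 2 < K.\<close>
  have cover: "n \<le> fst \<mu> \<or> m \<le> snd \<mu>" if "K < mdeg \<mu>" for \<mu>
    using that nm K by (auto simp: mdeg_def)
  from pq have "(\<exists>e1 e2 p q \<tau>. moment_recursion K e1 e2 p q \<tau> (case_prod \<alpha>))"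
  proof (elim disjE conjE)
    assume p: "p \<in> polys_upto (n - 1)" and q: "q \<in> polys_upto m" "lookup q (0, m) = 0"
    \<comment> \<open>The weight is the y-exponent: among the monomials of degree m only y^m has
      y-exponent m, and it does not occur in \<open>q\<close>. In the other case x and y exchange
      roles and the weight is the x-exponent.\<close>
    have "moment_recursion K (n, 0) (0, m) p q snd (case_prod \<alpha>)"
    proof (rule moment_recursion_if_psd[OF psd rg deg sq])
      show "mdeg \<kappa> < mdeg (n, 0)" if "\<kappa> \<in> keys p" for \<kappa>
        using p nm that by (fastforce simp: polys_upto_iff mdeg_def)
      show "mdeg \<kappa> < mdeg (0, m) \<or> mdeg \<kappa> = mdeg (0, m) \<and> snd \<kappa> < snd (0, m)"
        if "\<kappa> \<in> keys q" for \<kappa>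
      proof -
        have "mdeg \<kappa> \<le> m" "\<kappa> \<noteq> (0, m)"
          using q that by (auto simp: polys_upto_iff in_keys_iff)
        then show ?thesis
          by (cases \<kappa>) (auto simp: mdeg_def)
      qed
      show "\<exists>\<kappa>. \<mu> = (n, 0) + \<kappa>" if "(0, m) + \<mu> = (n, 0) + \<nu>" for \<mu> \<nu>
        using arg_cong[OF that, of fst] unfolding div by simp
    qed (unfold div, use cover in auto)
    then show ?thesis
      by blast
  next
    assume q: "q \<in> polys_upto (m - 1)" and p: "p \<in> polys_upto n" "lookup p (n, 0) = 0"
    have "moment_recursion K (0, m) (n, 0) q p fst (case_prod \<alpha>)"
    proof (rule moment_recursion_if_psd[OF psd rg deg(2,1) sq(2,1)])
      show "mdeg \<kappa> < mdeg (0, m)" if "\<kappa> \<in> keys q" for \<kappa>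
        using q nm that by (fastforce simp: polys_upto_iff mdeg_def)
      show "mdeg \<kappa> < mdeg (n, 0) \<or> mdeg \<kappa> = mdeg (n, 0) \<and> fst \<kappa> < fst (n, 0)"
        if "\<kappa> \<in> keys p" for \<kappa>
      proof -
        have "mdeg \<kappa> \<le> n" "\<kappa> \<noteq> (n, 0)"
          using p that by (auto simp: polys_upto_iff in_keys_iff)
        then show ?thesis
          by (cases \<kappa>) (auto simp: mdeg_def)
      qed
      show "\<exists>\<kappa>. \<mu> = (0, m) + \<kappa>" if "(n, 0) + \<mu> = (0, m) + \<nu>" for \<mu> \<nu>
        using arg_cong[OF that, of snd] unfolding div by simp
    qed (unfold div, use cover in auto)
    then show ?thesis
      by blast
  qed
  then obtain e1 e2 p q \<tau> where "moment_recursion K e1 e2 p q \<tau> (case_prod \<alpha>)"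
    by blast
  then have "\<exists>W w. finite W \<and> (\<forall>p\<in>W. 0 \<le> w p) \<and>
      (\<forall>i j. i + j \<le> 2 * K \<longrightarrow> case_prod \<alpha> (i, j) = (\<Sum>p\<in>W. w p * (fst p ^ i * snd p ^ j)))"
    by (rule moment_recursion.atomic_moments)
  then obtain W w where W: "finite W \<and> (\<forall>p\<in>W. 0 \<le> w p) \<and>
      (\<forall>i j. i + j \<le> 2 * K \<longrightarrow> case_prod \<alpha> (i, j) = (\<Sum>p\<in>W. w p * (fst p ^ i * snd p ^ j)))"
    by (elim exE) (rule that)
  have *: "\<beta> i j = (\<Sum>p\<in>W. w p * (fst p ^ i * snd p ^ j))" if "i + j \<le> 2 * d" for i j
    using W \<alpha>[of i j] that K by simp
  show ?thesis
    by (rule exI, rule representing_measure_atomic[of W w]) (use W * in simp_all)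
qed

end
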